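(* Consider an association $a(Y,\theta,U)=0$ and observed data $y$. Assume that $P(U^\star\in\mathcal M_{y,0})=1$ and that the predictive random set $\mathcal S$ satisfies $P(\gamma(U^\star)\le\alpha)\le\alpha$ for all $\alpha\in(0,1)$, where $\gamma(u)=P(u\in\mathcal S)$. Then for every measurable $A\subset\Theta$, $$\operatorname{bel}_y(A)\le \operatorname{fid}_y(A)\le \operatorname{pl}_y(A).$$
   Context: **Association.** $\Theta$ is the parameter space and $Y$ has density $f(y\mid\theta)$ with respect to some dominating measure. An association is a measurable function $a(y,\theta,u)$ such that for every $\theta\in\Theta$ there exist random variables $U,Y$ on a common probability space with $a(Y,\theta,U)=0$, where $U$ has a known distribution (density $f_U$) not depending on unknown parameters and $Y$ has density $f(y\mid\theta)$. In particular, for any observed $y$ and any $\theta$ there is at least one $u_{y,\theta}$ with $a(y,\theta,u_{y,\theta})=0$. $U^\star$ denotes a random variable with the same distribution as $U$. Set $\Theta_y(u)=\{\theta: a(y,\theta,u)=0\}$. **Inferential model (IM).** A predictive random set is a random set $\mathcal S:\Omega\to 2^{R(U)}$, where $R(U)$ is the range of $U$. Put $\gamma(u)=P(u\in\mathcal S)$ and $\Theta_y(\mathcal S)=\bigcup_{u\in\mathcal S}\Theta_y(u)$. For an assertion $A\subset\Theta$, the belief and plausibility are $$\operatorname{bel}_y(A)=P(\Theta_y(\mathcal S)\subset A\mid\Theta_y(\mathcal S)\ne\emptyset),\qquad \operatorname{pl}_y(A)=1-\operatorname{bel}_y(A^c)=P(\Theta_y(\mathcal S)\cap A\neq\emptyset\mid\Theta_y(\mathcal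 S)\neq\emptyset),$$ where regular outer measure is used if $\{\Theta_y(\mathcal S)\subset A\}$ is not measurable. **Generalized fiducial distribution.** Let $Q_y(u)\in\arg\min_{\theta}\|a(y,\theta,u)\|$ (typically the $\ell_2$ or $\ell_\infty$ norm); if there is more than one minimizer, one is selected by some possibly random rule, and different selection rules give different versions of the fiducial distribution. For $\epsilon\ge0$ let $\mathcal M_{y,\epsilon}=\{u:\|a(y,Q_y(u),u)\|\le\epsilon\}$. For $\epsilon>0$ let $U^\star_\epsilon$ have the distribution of $U$ truncated to $\mathcal M_{y,\epsilon}$ and $\theta^\star_\epsilon=Q_y(U^\star_\epsilon)$. Assuming $\theta^\star_\epsilon$ converges in distribution as $\epsilon\to0$, with limit $\theta^\star$, the fiducial probability is $\operatorname{fid}_y(A)=P(\theta^\star\in A)$ with $y$ fixed. If $P(U^\star\in\mathcal M_{y,0})>0$ then $\operatorname{fid}_y(A)=P(Q_y(U^\star)\in A\mid U^\star\in\mathcal M_{y,0})$. Thus the claim concerns any version of the fiducial distribution. *)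

theory Defs
  imports "HOL-Probability.Probability"
begin

text \<open>
  Conventions. The parameter space is a subset \<open>\<Theta>\<close> of a metric space, with its Borel sets
  \<open>restrict_space borel \<Theta>\<close>. The data space is \<open>space MY\<close> and the range of \<open>U\<close>
  is \<open>space MU\<close>, where \<open>MY\<close>, \<open>MU\<close> are the dominating measures of the densities
  \<open>f(\<cdot> | \<theta>)\<close> (written \<open>f \<theta>\<close>) and \<open>fU\<close>; so \<open>density MU fU\<close> is the law
  of \<open>U\<close>, and of \<open>U\<^sup>*\<close>.
\<close>

section \<open>Associations\<close>

text \<open>
  HOL cannot quantify existentially over the type of the common sample space of \<open>Y\<close> and \<open>U\<close>.
  The type \<open>'y \<times> 'u\<close> is no restriction, because any such pair may be replaced by the
  coordinate projections under its joint law.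

  Solvability of \<open>a(y, \<theta>, u) = 0\<close> in \<open>u\<close> is what the definition entails for \<open>y = Y(\<omega>)\<close>. It is not
  imposed on every pair \<open>(y, \<theta>)\<close> in \<open>space MY \<times> \<Theta>\<close>: it fails for
  \<open>y = 5\<close>, \<open>\<theta> = 1\<close> in \<open>Y = \<theta> U\<close> with \<open>U\<close> uniform on \<open>(0, 1)\<close>.
\<close>

definition association ::
  "'t::metric_space set \<Rightarrow> 'y measure \<Rightarrow> ('t \<Rightarrow> 'y \<Rightarrow> ennreal) \<Rightarrow> 'u measure \<Rightarrow> ('u \<Rightarrow> ennreal)
    \<Rightarrow> ('y \<Rightarrow> 't \<Rightarrow> 'u \<Rightarrow> 'c::euclidean_space) \<Rightarrow> bool" where
  "association \<Theta> MY f MU fU a \<longleftrightarrow>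
     (\<lambda>(y, \<theta>, u). a y \<theta> u) \<in> borel_measurable (MY \<Otimes>\<^sub>M restrict_space borel \<Theta> \<Otimes>\<^sub>M MU) \<and>
     (\<forall>\<theta>\<in>\<Theta>. \<exists>(M :: ('y \<times> 'u) measure) Y U.
        prob_space M \<and> distributed M MY Y (f \<theta>) \<and> distributed M MU U fU \<and>
        (AE \<omega> in M. a (Y \<omega>) \<theta> (U \<omega>) = 0))"

definition param_set :: "'t set \<Rightarrow> ('y \<Rightarrow> 't \<Rightarrow> 'u \<Rightarrow> 'c::zero) \<Rightarrow> 'y \<Rightarrow> 'u \<Rightarrow> 't set" where
  "param_set \<Theta> a y u = {\<theta>\<in>\<Theta>. a y \<theta> u = 0}"

section \<open>Inferential models\<close>

definition coverage :: "'w measure \<Rightarrow> ('w \<Rightarrow> 'u set) \<Rightarrow> 'u \<Rightarrow> real" where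
  "coverage W S u = measure W {\<omega>\<in>space W. u \<in> S \<omega>}"

text \<open>
  The two measurability conditions are exactly what is needed for \<open>\<gamma>(u) = P(u \<in> S)\<close> and
  \<open>P(\<gamma>(U\<^sup>*) \<le> \<alpha>)\<close> to be defined.
\<close>

definition predictive_random_set :: "'w measure \<Rightarrow> 'u measure \<Rightarrow> ('w \<Rightarrow> 'u set) \<Rightarrow> bool" where
  "predictive_random_set W MU S \<longleftrightarrow>
     prob_space W \<and>
     (\<forall>\<omega>\<in>space W. S \<omega> \<subseteq> space MU) \<and>
     (\<forall>u\<in>space MU. {\<omega>\<in>space W. u \<in> S \<omega>} \<in> sets W) \<and>
     coverage W S \<in> borel_measurable MU"

definition random_param_set ::
  "'t set \<Rightarrow> ('y \<Rightarrow> 't \<Rightarrow> 'u \<Rightarrow> 'c::zero) \<Rightarrow> 'y \<Rightarrow> 'u set \<Rightarrow> 't set" where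
  "random_param_set \<Theta> a y s = (\<Union>u\<in>s. param_set \<Theta> a y u)"

definition outer_prob :: "'w measure \<Rightarrow> 'w set \<Rightarrow> real" where
  "outer_prob W E = enn2real (outer_measure_of W E)"

definition bel ::
  "'t set \<Rightarrow> ('y \<Rightarrow> 't \<Rightarrow> 'u \<Rightarrow> 'c::zero) \<Rightarrow> 'w measure \<Rightarrow> ('w \<Rightarrow> 'u set) \<Rightarrow> 'y \<Rightarrow> 't set \<Rightarrow> real" where
  "bel \<Theta> a W S y A =
     outer_prob W {\<omega>\<in>space W. random_param_set \<Theta> a y (S \<omega>) \<subseteq> A \<and> random_param_set \<Theta> a y (S \<omega>) \<noteq> {}}
     / outer_prob W {\<omega>\<in>space W. random_param_set \<Theta> a y (S \<omega>) \<noteq> {}}"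

definition pl ::
  "'t set \<Rightarrow> ('y \<Rightarrow> 't \<Rightarrow> 'u \<Rightarrow> 'c::zero) \<Rightarrow> 'w measure \<Rightarrow> ('w \<Rightarrow> 'u set) \<Rightarrow> 'y \<Rightarrow> 't set \<Rightarrow> real" where
  "pl \<Theta> a W S y A = 1 - bel \<Theta> a W S y (\<Theta> - A)"

lemma outer_prob_eq_measure: "E \<in> sets W \<Longrightarrow> outer_prob W E = measure W E"
  by (simp add: outer_prob_def measure_def)

lemma pl_eq_hitting_prob:
  fixes T :: "'w \<Rightarrow> 't set"
  assumes T_def: "T = (\<lambda>\<omega>. random_param_set \<Theta> a y (S \<omega>))"
    and "prob_space W"
    and hit: "{\<omega>\<in>space W. T \<omega> \<inter> A \<noteq> {}} \<in> sets W"
    and ne: "{\<omega>\<in>space W. T \<omega> \<noteq> {}} \<in> sets W"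
    and pos: "measure W {\<omega>\<in>space W. T \<omega> \<noteq> {}} > 0"
  shows "pl \<Theta> a W S y A =
    measure W {\<omega>\<in>space W. T \<omega> \<inter> A \<noteq> {} \<and> T \<omega> \<noteq> {}} / measure W {\<omega>\<in>space W. T \<omega> \<noteq> {}}"
proof -
  interpret prob_space W by fact
  define H N where "H = {\<omega>\<in>space W. T \<omega> \<inter> A \<noteq> {}}" and "N = {\<omega>\<in>space W. T \<omega> \<noteq> {}}"
  have sub: "T \<omega> \<subseteq> \<Theta>" for \<omega>
    by (auto simp: T_def random_param_set_def param_set_def)
  have E: "{\<omega>\<in>space W. T \<omega> \<subseteq> \<Theta> - A \<and> T \<omega> \<noteq> {}} = N - H"
    unfolding H_def N_def
  proof (intro set_eqI)
    fix \<omega>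
    show "\<omega> \<in> {\<omega>\<in>space W. T \<omega> \<subseteq> \<Theta> - A \<and> T \<omega> \<noteq> {}} \<longleftrightarrow>
        \<omega> \<in> {\<omega>\<in>space W. T \<omega> \<noteq> {}} - {\<omega>\<in>space W. T \<omega> \<inter> A \<noteq> {}}"
      using sub[of \<omega>] by auto
  qed
  have H: "{\<omega>\<in>space W. T \<omega> \<inter> A \<noteq> {} \<and> T \<omega> \<noteq> {}} = H"
    by (auto simp: H_def)
  have HN: "H \<in> sets W" "N \<in> sets W" "measure W N > 0" "H \<subseteq> N"
    using hit ne pos by (auto simp: H_def N_def)
  have "outer_prob W (N - H) = measure W N - measure W H"
    using HN by (simp add: outer_prob_eq_measure finite_measure_Diff)
  moreover have "pl \<Theta> a W S y A = 1 - outer_prob W (N - H) / outer_prob W N"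
    unfolding E[symmetric] unfolding pl_def bel_def N_def T_def ..
  ultimately have "pl \<Theta> a W S y A = 1 - (measure W N - measure W H) / measure W N"
    using HN(2) by (simp add: outer_prob_eq_measure)
  also have "\<dots> = measure W H / measure W N"
    using HN(3) by (simp add: diff_divide_distrib)
  finally show ?thesis
    unfolding H N_def .
qed

section \<open>Generalized fiducial distributions\<close>

text \<open>
  An explicit norm on the Euclidean codomain of \<open>a\<close>, so that both the \<open>\<ell>\<^sub>2\<close> and the
  \<open>\<ell>\<^sub>\<infinity>\<close> norm are instances.
\<close>

definition is_norm :: "('c::real_vector \<Rightarrow> real) \<Rightarrow> bool" where
  "is_norm nrm \<longleftrightarrow>
     (\<forall>x. 0 \<le> nrm x) \<and> (\<forall>x. nrm x = 0 \<longleftrightarrow> x = 0) \<and>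
     (\<forall>r x. nrm (r *\<^sub>R x) = \<bar>r\<bar> * nrm x) \<and> (\<forall>x z. nrm (x + z) \<le> nrm x + nrm z)"

text \<open>
  A possibly random selection rule: \<open>Q v u\<close> is a minimizer \<open>Q\<^sub>y(u)\<close>, where \<open>v\<close> is drawn from the
  probability space \<open>R\<close> independently of \<open>U\<^sup>*\<close>. A deterministic rule is one not depending on \<open>v\<close>.
\<close>

definition selection_rule ::
  "'t::metric_space set \<Rightarrow> 'u measure \<Rightarrow> ('y \<Rightarrow> 't \<Rightarrow> 'u \<Rightarrow> 'c) \<Rightarrow> ('c \<Rightarrow> real) \<Rightarrow> 'y
    \<Rightarrow> 'v measure \<Rightarrow> ('v \<Rightarrow> 'u \<Rightarrow> 't) \<Rightarrow> bool" where
  "selection_rule \<Theta> MU a nrm y R Q \<longleftrightarrow>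
     prob_space R \<and>
     (\<lambda>(v, u). Q v u) \<in> measurable (R \<Otimes>\<^sub>M MU) (restrict_space borel \<Theta>) \<and>
     (\<forall>v\<in>space R. \<forall>u\<in>space MU. is_arg_min (\<lambda>\<theta>. nrm (a y \<theta> u)) (\<lambda>\<theta>. \<theta> \<in> \<Theta>) (Q v u))"

text \<open>
  The set \<open>\<M>\<^bsub>y,\<epsilon>\<^esub>\<close>. Minimizers all attain the same value, so the quantifier over \<open>v\<close> is
  immaterial; see \<open>fid_region_eq\<close>.
\<close>

definition fid_region ::
  "'u measure \<Rightarrow> ('y \<Rightarrow> 't \<Rightarrow> 'u \<Rightarrow> 'c) \<Rightarrow> ('c \<Rightarrow> real) \<Rightarrow> 'y
    \<Rightarrow> 'v measure \<Rightarrow> ('v \<Rightarrow> 'u \<Rightarrow> 't) \<Rightarrow> real \<Rightarrow> 'u set" where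
  "fid_region MU a nrm y R Q \<epsilon> = {u\<in>space MU. \<forall>v\<in>space R. nrm (a y (Q v u) u) \<le> \<epsilon>}"

lemma fid_region_eq:
  assumes "selection_rule \<Theta> MU a nrm y R Q" and "v \<in> space R"
  shows "fid_region MU a nrm y R Q \<epsilon> = {u\<in>space MU. nrm (a y (Q v u) u) \<le> \<epsilon>}"
proof -
  have min: "nrm (a y (Q x u) u) \<le> nrm (a y (Q z u) u)"
    if "x \<in> space R" "z \<in> space R" "u \<in> space MU" for x z u
  proof -
    have "is_arg_min (\<lambda>\<theta>. nrm (a y \<theta> u)) (\<lambda>\<theta>. \<theta> \<in> \<Theta>) (Q w u)" if "w \<in> space R" for w
      using assms(1) that \<open>u \<in> space MU\<close> unfolding selection_rule_def by blast
    from this[OF that(1)] this[OF that(2)] show ?thesis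
      unfolding is_arg_min_def not_less[symmetric] by blast
  qed
  show ?thesis
    unfolding fid_region_def by (blast intro: assms(2) order_trans[OF min[OF _ assms(2)]])
qed

text \<open>
  The law of \<open>\<theta>\<^sup>*\<^sub>\<epsilon> = Q\<^sub>y(U\<^sup>*\<^sub>\<epsilon>)\<close>, where \<open>U\<^sup>*\<^sub>\<epsilon>\<close> has the law of \<open>U\<close> conditioned on \<open>\<M>\<^bsub>y,\<epsilon>\<^esub>\<close>
  and is independent of the randomization of the selection rule.
\<close>

definition fid_law_eps ::
  "'t::metric_space set \<Rightarrow> 'u measure \<Rightarrow> ('u \<Rightarrow> ennreal) \<Rightarrow> ('y \<Rightarrow> 't \<Rightarrow> 'u \<Rightarrow> 'c) \<Rightarrow> ('c \<Rightarrow> real) \<Rightarrow> 'y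
    \<Rightarrow> 'v measure \<Rightarrow> ('v \<Rightarrow> 'u \<Rightarrow> 't) \<Rightarrow> real \<Rightarrow> 't measure" where
  "fid_law_eps \<Theta> MU fU a nrm y R Q \<epsilon> =
     distr (R \<Otimes>\<^sub>M uniform_measure (density MU fU) (fid_region MU a nrm y R Q \<epsilon>))
       (restrict_space borel \<Theta>) (\<lambda>(v, u). Q v u)"

definition limit_in_distribution ::
  "'t::metric_space set \<Rightarrow> (real \<Rightarrow> 't measure) \<Rightarrow> 't measure \<Rightarrow> bool" where
  "limit_in_distribution \<Theta> L \<mu> \<longleftrightarrow>
     prob_space \<mu> \<and> sets \<mu> = sets (restrict_space borel \<Theta>) \<and>
     (\<forall>g :: 't \<Rightarrow> real. continuous_on \<Theta> g \<and> bounded (g ` \<Theta>) \<longrightarrow>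
        ((\<lambda>\<epsilon>. \<integral>\<theta>. g \<theta> \<partial>L \<epsilon>) \<longlongrightarrow> (\<integral>\<theta>. g \<theta> \<partial>\<mu>)) (at_right 0))"

definition fid ::
  "'t::metric_space set \<Rightarrow> 'u measure \<Rightarrow> ('u \<Rightarrow> ennreal) \<Rightarrow> ('y \<Rightarrow> 't \<Rightarrow> 'u \<Rightarrow> 'c) \<Rightarrow> ('c \<Rightarrow> real) \<Rightarrow> 'y
    \<Rightarrow> 'v measure \<Rightarrow> ('v \<Rightarrow> 'u \<Rightarrow> 't) \<Rightarrow> 't set \<Rightarrow> real" where
  "fid \<Theta> MU fU a nrm y R Q A =
     measure (THE \<mu>. limit_in_distribution \<Theta> (fid_law_eps \<Theta> MU fU a nrm y R Q) \<mu>) A"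

end

theory Submission
  imports Defs
begin

text \<open>
  The set \<open>\<M>\<^bsub>y,0\<^esub>\<close> has full measure, so truncation does nothing and the fiducial distribution is the law of
  \<open>Q\<^sub>y(U\<^sup>*)\<close>. If \<open>u \<in> \<M>\<^bsub>y,0\<^esub>\<close> and \<open>Q\<^sub>y(u) \<notin> A\<close>, then \<open>u \<in> S\<close> forces \<open>\<Theta>\<^sub>y(S) \<not>\<subseteq> A\<close>, so that
  \<open>\<gamma>(u) \<le> 1 - \<beta>\<close>, where \<open>\<beta>\<close> is the outer probability of \<open>\<emptyset> \<noteq> \<Theta>\<^sub>y(S) \<subseteq> A\<close>. Hence
  \<open>P(Q\<^sub>y(U\<^sup>*) \<notin> A) \<le> P(\<gamma>(U\<^sup>*) \<le> 1 - \<beta>) \<le> 1 - \<beta>\<close>. Validity also makes \<open>\<gamma>\<close> arbitrarily close to 1 on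
  \<open>\<M>\<^bsub>y,0\<^esub>\<close>, so \<open>\<Theta>\<^sub>y(S) \<noteq> \<emptyset>\<close> has outer probability 1 and \<open>\<beta>\<close> is the belief of \<open>A\<close>. The bound by the
  plausibility follows by passing to complements.
\<close>

section \<open>Uniqueness of limits in distribution on a subset of a metric space\<close>

lemma sets_restrict_space_borel_closed:
  "sets (restrict_space borel \<Theta>) = sigma_sets \<Theta> {C \<inter> \<Theta> | C. closed C}"
    for \<Theta> :: "'t::topological_space set"
proof -
  have "sets (restrict_space borel \<Theta>) = {id -` B \<inter> \<Theta> | B. B \<in> sigma_sets UNIV (Collect closed)}"
    by (auto simp: sets_restrict_space borel_eq_closed)
  also have "\<dots> = sigma_sets \<Theta> {id -` C \<inter> \<Theta> | C. C \<in> Collect closed}"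
    by (rule sigma_sets_vimage_commute) auto
  finally show ?thesis
    by simp
qed

text \<open>Bounded continuous approximation of a closed set: outside \<open>C\<close> the distance
  is positive, so the n-th function vanishes once n exceeds its reciprocal. Nonemptiness matters
  because \<open>infdist x {}\<close> is 0 by convention, which would make every function constantly
  1.\<close>

lemma tendsto_max_infdist_indicator:
  fixes C :: "'t::metric_space set"
  assumes "closed C" "C \<noteq> {}"
  shows "(\<lambda>n. max 0 (1 - real n * infdist x C)) \<longlonglongrightarrow> indicator C x"
proof (cases "x \<in> C")
  case True
  then show ?thesis by simp
next
  case False
  then have pos: "infdist x C > 0"
    using infdist_pos_not_in_closed[OF assms False] by simp
  have "\<forall>\<^sub>F n in sequentially. real n > 1 / infdist x C"
    using filterlim_real_sequentially filterlim_at_top_dense by blast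
  then have "\<forall>\<^sub>F n in sequentially. max 0 (1 - real n * infdist x C) = indicator C x"
    by eventually_elim (use pos False in \<open>auto simp: field_simps max_def\<close>)
  then show ?thesis
    by (rule tendsto_eventually)
qed

text \<open>Dominated convergence along the distance functions recovers the measure of every closed
  trace \<open>C \<inter> \<Theta>\<close> from integrals of bounded continuous functions. These
  traces are stable under intersection, contain \<open>\<Theta>\<close> and generate the Borel sets
  of \<open>\<Theta>\<close>, so a pi-system argument finishes.\<close>

lemma measure_eqI_bounded_continuous:
  fixes \<Theta> :: "'t::metric_space set"
  assumes "finite_measure M" "finite_measure N"
    and sM: "sets M = sets (restrict_space borel \<Theta>)"
    and sN: "sets N = sets (restrict_space borel \<Theta>)"
    and eq: "\<And>g :: 't \<Rightarrow> real. continuous_on \<Theta> g \<Longrightarrow> bounded (g ` \<Theta>) \<Longrightarrow>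
      (\<integral>x. g x \<partial>M) = (\<integral>x. g x \<partial>N)"
  shows "M = N"
proof -
  interpret M: finite_measure M by fact
  interpret N: finite_measure N by fact
  have closed_lim: "(\<lambda>n. \<integral>x. max 0 (1 - real n * infdist x C) \<partial>L) \<longlonglongrightarrow> measure L (C \<inter> \<Theta>)"
    if "finite_measure L" and sL: "sets L = sets (restrict_space borel \<Theta>)"
      and C: "closed C" "C \<noteq> {}" for L and C :: "'t set"
  proof -
    interpret finite_measure L by fact
    have spL: "space L = \<Theta>"
      using sets_eq_imp_space_eq[OF sL] by (simp add: space_restrict_space)
    have CL: "C \<inter> \<Theta> \<in> sets L"
      unfolding sL sets_restrict_space_borel_closed using C by blast
    have "(\<lambda>n. \<integral>x. max 0 (1 - real n * infdist x C) \<partial>L) \<longlonglongrightarrow> (\<integral>x. indicator (C \<inter> \<Theta>) x \<partial>L)"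
    proof (rule integral_dominated_convergence[where w = "\<lambda>_. 1"])
      show "indicator (C \<inter> \<Theta>) \<in> borel_measurable L"
        using CL by simp
      show "(\<lambda>x. max 0 (1 - real n * infdist x C)) \<in> borel_measurable L" for n
        unfolding measurable_cong_sets[OF sL refl]
        by (intro measurable_restrict_space1 borel_measurable_continuous_onI continuous_intros)
      show "AE x in L. (\<lambda>n. max 0 (1 - real n * infdist x C)) \<longlonglongrightarrow> indicator (C \<inter> \<Theta>) x"
        using tendsto_max_infdist_indicator[OF C] by (intro AE_I2) (simp add: spL indicator_def)
      show "AE x in L. norm (max 0 (1 - real n * infdist x C)) \<le> 1" for n
        by (simp add: max_def infdist_nonneg)
    qed simp
    then show ?thesis
      using CL by simp
  qed
  have closed_eq: "emeasure M X = emeasure N X" if "X \<in> {C \<inter> \<Theta> | C. closed C}" for X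
  proof -
    from that obtain C where C: "closed C" and X: "X = C \<inter> \<Theta>" by blast
    show ?thesis
    proof (cases "C = {}")
      case False
      have "(\<integral>x. max 0 (1 - real n * infdist x C) \<partial>M) = (\<integral>x. max 0 (1 - real n * infdist x C) \<partial>N)" for n
      proof (rule eq)
        show "continuous_on \<Theta> (\<lambda>x. max 0 (1 - real n * infdist x C))"
          by (intro continuous_intros)
        show "bounded ((\<lambda>x. max 0 (1 - real n * infdist x C)) ` \<Theta>)"
          by (intro boundedI[where B = 1]) (auto simp: max_def infdist_nonneg)
      qed
      then have "measure M X = measure N X"
        using LIMSEQ_unique[OF closed_lim[OF assms(1) sM C False]] closed_lim[OF assms(2) sN C False]
        unfolding X by presburger
      then show ?thesis
        by (simp add: M.emeasure_eq_measure N.emeasure_eq_measure)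
    qed (simp add: X)
  qed
  show ?thesis
  proof (rule measure_eqI_generator_eq[where E = "{C \<inter> \<Theta> | C. closed C}" and \<Omega> = \<Theta> and A = "\<lambda>_. \<Theta>"])
    show "Int_stable {C \<inter> \<Theta> | C. closed C}"
    proof (rule Int_stableI)
      fix X Z assume "X \<in> {C \<inter> \<Theta> | C. closed C}" "Z \<in> {C \<inter> \<Theta> | C. closed C}"
      then obtain C D where "closed C" "closed D" "X = C \<inter> \<Theta>" "Z = D \<inter> \<Theta>" by blast
      then have "closed (C \<inter> D) \<and> X \<inter> Z = (C \<inter> D) \<inter> \<Theta>" by auto
      then show "X \<inter> Z \<in> {C \<inter> \<Theta> | C. closed C}" by blast
    qed
    have "\<Theta> = UNIV \<inter> \<Theta> \<and> closed (UNIV :: 't set)" by simp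
    then show "range (\<lambda>_::nat. \<Theta>) \<subseteq> {C \<inter> \<Theta> | C. closed C}" by blast
  qed (use sM sN closed_eq in \<open>auto simp: sets_restrict_space_borel_closed\<close>)
qed

text \<open>This gives the definite description in \<open>fid\<close> its meaning.\<close>

lemma limit_in_distribution_unique:
  assumes "limit_in_distribution \<Theta> L \<mu>" "limit_in_distribution \<Theta> L \<nu>"
  shows "\<mu> = \<nu>"
proof (rule measure_eqI_bounded_continuous)
  fix g :: "'a \<Rightarrow> real" assume "continuous_on \<Theta> g" "bounded (g ` \<Theta>)"
  then show "(\<integral>x. g x \<partial>\<mu>) = (\<integral>x. g x \<partial>\<nu>)"
    using assms unfolding limit_in_distribution_def
    by (intro tendsto_unique[OF trivial_limit_at_right_real]) blast+
qed (use assms in \<open>auto simp: limit_in_distribution_def prob_space.finite_measure\<close>)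

section \<open>The fiducial distribution as the law of the selected minimizer\<close>

text \<open>A norm is convex, and a finite convex function on a Euclidean space is continuous.
  Measurability of the regions rests on this.\<close>

lemma is_norm_continuous:
  fixes nrm :: "'c::euclidean_space \<Rightarrow> real"
  assumes "is_norm nrm"
  shows "continuous_on UNIV nrm"
proof (rule convex_on_continuous)
  show "convex_on UNIV nrm"
  proof (rule convex_onI)
    fix t :: real and x z assume "0 < t" "t < 1"
    moreover have "nrm ((1 - t) *\<^sub>R x + t *\<^sub>R z) \<le> nrm ((1 - t) *\<^sub>R x) + nrm (t *\<^sub>R z)"
      using assms unfolding is_norm_def by blast
    ultimately show "nrm ((1 - t) *\<^sub>R x + t *\<^sub>R z) \<le> (1 - t) * nrm x + t * nrm z"
      using assms by (simp add: is_norm_def)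
  qed simp
qed simp

lemma (in prob_space) uniform_measure_eq_self:
  assumes "B \<in> events" "prob B = 1"
  shows "uniform_measure M B = M"
proof (rule measure_eqI)
  fix X assume "X \<in> sets (uniform_measure M B)"
  then have X: "X \<in> events" by simp
  have "AE x in M. x \<in> B"
    using assms by (simp add: prob_eq_1)
  then have "emeasure M (B \<inter> X) = emeasure M X"
    using X assms(1) by (intro emeasure_eq_AE) auto
  then show "emeasure (uniform_measure M B) X = emeasure M X"
    using X assms by (simp add: emeasure_eq_measure divide_ennreal_def)
qed simp

text \<open>The total mass of \<open>fU\<close> is controlled only through the variable
  \<open>U\<close> that the association supplies for a given parameter, hence the need for some
  \<open>\<theta> \<in> \<Theta>\<close>.\<close>

lemma association_prob_space:
  assumes "association \<Theta> MY f MU fU a" "\<theta> \<in> \<Theta>"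
  shows "prob_space (density MU fU)"
proof -
  obtain M :: "('b \<times> 'c) measure" and U where "prob_space M" "distributed M MU U fU"
    using assms unfolding association_def by blast
  then show ?thesis
    by (metis distributed_distr_eq_density distributed_measurable prob_space.prob_space_distr)
qed

text \<open>By \<open>fid_region_eq\<close> a single \<open>v\<close> describes the region, so an
  intersection over possibly uncountably many \<open>v\<close> becomes a sublevel set of one
  measurable function of \<open>u\<close>.\<close>

lemma fid_region_measurable:
  fixes a :: "'y \<Rightarrow> 't::metric_space \<Rightarrow> 'u \<Rightarrow> 'c::euclidean_space"
  assumes "association \<Theta> MY f MU fU a" "y \<in> space MY" "is_norm nrm"
    and sel: "selection_rule \<Theta> MU a nrm y R Q"
  shows "fid_region MU a nrm y R Q \<epsilon> \<in> sets MU"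
proof -
  interpret R: prob_space R
    using sel by (simp add: selection_rule_def)
  obtain v where v: "v \<in> space R"
    using R.not_empty by blast
  have "(\<lambda>(v, u). Q v u) \<in> measurable (R \<Otimes>\<^sub>M MU) (restrict_space borel \<Theta>)"
    using sel by (simp add: selection_rule_def)
  from measurable_compose[OF measurable_Pair1'[OF v] this]
  have Qv: "Q v \<in> measurable MU (restrict_space borel \<Theta>)"
    by simp
  have emb: "(\<lambda>u. (y, Q v u, u)) \<in> measurable MU (MY \<Otimes>\<^sub>M restrict_space borel \<Theta> \<Otimes>\<^sub>M MU)"
    using Qv assms(2) by simp
  have "(\<lambda>(y, \<theta>, u). a y \<theta> u) \<in> borel_measurable (MY \<Otimes>\<^sub>M restrict_space borel \<Theta> \<Otimes>\<^sub>M MU)"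
    using assms(1) by (simp add: association_def)
  from measurable_compose[OF emb this]
  have "(\<lambda>u. a y (Q v u) u) \<in> borel_measurable MU"
    by simp
  from measurable_compose[OF this borel_measurable_continuous_onI[OF is_norm_continuous[OF assms(3)]]]
  show ?thesis
    unfolding fid_region_eq[OF sel v] by measurable
qed

text \<open>The regions grow with \<open>\<epsilon>\<close>, so all of them have full measure once
  the one at 0 does. The truncated laws then do not depend on \<open>\<epsilon>\<close>, and their
  common value is the limit.\<close>

lemma fid_eq_selection_law:
  fixes a :: "'y \<Rightarrow> 't::metric_space \<Rightarrow> 'u \<Rightarrow> 'c::euclidean_space"
  assumes "association \<Theta> MY f MU fU a" "y \<in> space MY" "is_norm nrm"
    and sel: "selection_rule \<Theta> MU a nrm y R Q"
    and P: "prob_space (density MU fU)"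
    and full: "measure (density MU fU) (fid_region MU a nrm y R Q 0) = 1"
  shows "fid \<Theta> MU fU a nrm y R Q A =
    measure (distr (R \<Otimes>\<^sub>M density MU fU) (restrict_space borel \<Theta>) (\<lambda>(v, u). Q v u)) A"
proof -
  interpret P: prob_space "density MU fU" by fact
  interpret R: prob_space R
    using sel by (simp add: selection_rule_def)
  interpret RP: pair_prob_space R "density MU fU" ..
  let ?\<mu> = "distr (R \<Otimes>\<^sub>M density MU fU) (restrict_space borel \<Theta>) (\<lambda>(v, u). Q v u)"
  have law: "fid_law_eps \<Theta> MU fU a nrm y R Q \<epsilon> = ?\<mu>" if "\<epsilon> \<ge> 0" for \<epsilon>
  proof -
    have meas: "fid_region MU a nrm y R Q \<epsilon> \<in> P.events" for \<epsilon>
      using fid_region_measurable[OF assms(1-4)] by simp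
    have "fid_region MU a nrm y R Q 0 \<subseteq> fid_region MU a nrm y R Q \<epsilon>"
      using that by (force simp: fid_region_def)
    from P.finite_measure_mono[OF this meas]
    have "P.prob (fid_region MU a nrm y R Q \<epsilon>) = 1"
      using full by (simp add: P.measure_ge_1_iff)
    with meas show ?thesis
      by (simp add: fid_law_eps_def P.uniform_measure_eq_self)
  qed
  have "(\<lambda>(v, u). Q v u) \<in> measurable (R \<Otimes>\<^sub>M density MU fU) (restrict_space borel \<Theta>)"
    using sel by (simp add: selection_rule_def cong: measurable_cong_sets)
  then have "prob_space ?\<mu>"
    by (rule RP.prob_space_distr)
  moreover have "((\<lambda>\<epsilon>. \<integral>\<theta>. g \<theta> \<partial>fid_law_eps \<Theta> MU fU a nrm y R Q \<epsilon>) \<longlongrightarrow> (\<integral>\<theta>. g \<theta> \<partial>?\<mu>)) (at_right 0)"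
    for g :: "'t \<Rightarrow> real"
    by (intro tendsto_eventually eventually_at_rightI[of 0 1]) (auto simp: law)
  ultimately have "limit_in_distribution \<Theta> (fid_law_eps \<Theta> MU fU a nrm y R Q) ?\<mu>"
    by (simp add: limit_in_distribution_def)
  then have "(THE \<mu>. limit_in_distribution \<Theta> (fid_law_eps \<Theta> MU fU a nrm y R Q) \<mu>) = ?\<mu>"
    using limit_in_distribution_unique by (intro the_equality) blast+
  then show ?thesis
    by (simp add: fid_def)
qed

section \<open>Outer probability and coverage of the predictive random set\<close>

lemma (in prob_space) outer_prob_mono:
  assumes "E \<subseteq> F" "F \<subseteq> space M"
  shows "outer_prob M E \<le> outer_prob M F"
proof -
  \<comment> \<open>Finiteness has to be checked, since \<open>enn2real\<close> sends infinity to 0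
    and is monotone only below it.\<close>
  have "outer_measure_of M F \<le> outer_measure_of M (space M)"
    using assms(2) by (rule outer_measure_of_mono)
  then have "outer_measure_of M F < \<top>"
    by (simp add: emeasure_space_1 order_le_less_trans)
  then show ?thesis
    unfolding outer_prob_def using assms(1) by (intro enn2real_mono outer_measure_of_mono)
qed

text \<open>\<open>E\<close> may be nonmeasurable, but the event that \<open>S\<close> misses
  \<open>u\<close> is measurable. Its probability is one minus the coverage and dominates the outer
  probability of \<open>E\<close>.\<close>

lemma coverage_le_missing:
  assumes "predictive_random_set W MU S" "u \<in> space MU"
    and "E \<subseteq> {\<omega>\<in>space W. u \<notin> S \<omega>}"
  shows "coverage W S u \<le> 1 - outer_prob W E"
proof -
  interpret prob_space W
    using assms(1) by (simp add: predictive_random_set_def)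
  let ?H = "{\<omega>\<in>space W. u \<in> S \<omega>}"
  have H: "?H \<in> events"
    using assms(1,2) by (simp add: predictive_random_set_def)
  have eq: "{\<omega>\<in>space W. u \<notin> S \<omega>} = space W - ?H"
    by blast
  have "outer_prob W E \<le> outer_prob W (space W - ?H)"
    using assms(3) by (intro outer_prob_mono) (auto simp: eq)
  also have "\<dots> = 1 - coverage W S u"
    using H by (simp add: outer_prob_eq_measure prob_compl coverage_def)
  finally show ?thesis
    by simp
qed

lemma coverage_le_outer_prob:
  assumes "predictive_random_set W MU S" "u \<in> space MU"
    and "{\<omega>\<in>space W. u \<in> S \<omega>} \<subseteq> E" "E \<subseteq> space W"
  shows "coverage W S u \<le> outer_prob W E"
proof -
  interpret prob_space W
    using assms(1) by (simp add: predictive_random_set_def)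
  have "{\<omega>\<in>space W. u \<in> S \<omega>} \<in> events"
    using assms(1,2) by (simp add: predictive_random_set_def)
  then show ?thesis
    using outer_prob_mono[OF assms(3,4)] by (simp add: outer_prob_eq_measure coverage_def)
qed

lemma selection_mem_param_set:
  assumes "selection_rule \<Theta> MU a nrm y R Q" "is_norm nrm"
    and "v \<in> space R" "u \<in> fid_region MU a nrm y R Q 0"
  shows "Q v u \<in> param_set \<Theta> a y u"
proof -
  have u: "u \<in> space MU" "nrm (a y (Q v u) u) \<le> 0"
    using assms(3,4) by (auto simp: fid_region_def)
  then have "a y (Q v u) u = 0"
    using assms(2) unfolding is_norm_def by (metis order_antisym)
  moreover have "is_arg_min (\<lambda>\<theta>. nrm (a y \<theta> u)) (\<lambda>\<theta>. \<theta> \<in> \<Theta>) (Q v u)"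
    using assms(1,3) u unfolding selection_rule_def by blast
  ultimately show ?thesis
    by (simp add: param_set_def is_arg_min_def)
qed

text \<open>This makes the denominator in \<open>bel\<close> equal to 1, so that conditioning on a
  nonempty parameter set changes nothing.\<close>

lemma outer_prob_nonempty:
  assumes "prob_space (density MU fU)" "is_norm nrm"
    and sel: "selection_rule \<Theta> MU a nrm y R Q"
    and full: "measure (density MU fU) (fid_region MU a nrm y R Q 0) = 1"
    and prs: "predictive_random_set W MU S"
    and valid: "\<And>\<alpha>::real. 0 < \<alpha> \<Longrightarrow> \<alpha> < 1 \<Longrightarrow>
      measure (density MU fU) {u\<in>space MU. coverage W S u \<le> \<alpha>} \<le> \<alpha>"
  shows "outer_prob W {\<omega>\<in>space W. random_param_set \<Theta> a y (S \<omega>) \<noteq> {}} = 1"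
proof -
  interpret P: prob_space "density MU fU" by fact
  interpret W: prob_space W
    using prs by (simp add: predictive_random_set_def)
  interpret R: prob_space R
    using sel by (simp add: selection_rule_def)
  obtain v where v: "v \<in> space R"
    using R.not_empty by blast
  let ?M0 = "fid_region MU a nrm y R Q 0"
  let ?N = "{\<omega>\<in>space W. random_param_set \<Theta> a y (S \<omega>) \<noteq> {}}"
  have "\<alpha> \<le> outer_prob W ?N" if \<alpha>: "0 < \<alpha>" "\<alpha> < 1" for \<alpha>
  proof -
    \<comment> \<open>Were the coverage at most \<open>\<alpha>\<close> on the whole region,
      validity would bound the probability 1 of the region by \<open>\<alpha> < 1\<close>.\<close>
    have "\<exists>u\<in>?M0. \<alpha> < coverage W S u"
    proof (rule ccontr)
      assume "\<not> (\<exists>u\<in>?M0. \<alpha> < coverage W S u)"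
      then have "?M0 \<subseteq> {u\<in>space MU. coverage W S u \<le> \<alpha>}"
        by (auto simp: fid_region_def)
      moreover have "{u\<in>space MU. coverage W S u \<le> \<alpha>} \<in> P.events"
        using prs by (auto simp: predictive_random_set_def)
      ultimately have "1 \<le> P.prob {u\<in>space MU. coverage W S u \<le> \<alpha>}"
        using P.finite_measure_mono[of ?M0 "{u\<in>space MU. coverage W S u \<le> \<alpha>}"] full by linarith
      then show False
        using valid[OF \<alpha>] \<alpha> by simp
    qed
    then obtain u where u: "u \<in> ?M0" "\<alpha> < coverage W S u" by blast
    have "Q v u \<in> param_set \<Theta> a y u"
      by (rule selection_mem_param_set) fact+
    then have "{\<omega>\<in>space W. u \<in> S \<omega>} \<subseteq> ?N"
      by (auto simp: random_param_set_def)
    then have "coverage W S u \<le> outer_prob W ?N"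
      using u by (intro coverage_le_outer_prob[OF prs]) (auto simp: fid_region_def)
    then show ?thesis
      using u by simp
  qed
  \<comment> \<open>Let \<open>\<alpha>\<close> tend to 1 from below.\<close>
  then have "1 \<le> outer_prob W ?N"
    by (rule dense_le_bounded[OF zero_less_one])
  moreover have "outer_prob W ?N \<le> outer_prob W (space W)"
    by (rule W.outer_prob_mono) auto
  moreover have "outer_prob W (space W) = 1"
    using outer_prob_eq_measure[OF sets.top] W.prob_space by metis
  ultimately show ?thesis
    by linarith
qed

section \<open>Comparison of belief, fiducial probability and plausibility\<close>

lemma bel_le_fid:
  fixes a :: "'y \<Rightarrow> 't::metric_space \<Rightarrow> 'u \<Rightarrow> 'c::euclidean_space"
  assumes P: "prob_space (density MU fU)"
    and assoc: "association \<Theta> MY f MU fU a" "y \<in> space MY" "is_norm nrm"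
    and sel: "selection_rule \<Theta> MU a nrm y R Q"
    and full: "measure (density MU fU) (fid_region MU a nrm y R Q 0) = 1"
    and prs: "predictive_random_set W MU S"
    and valid: "\<And>\<alpha>::real. 0 < \<alpha> \<Longrightarrow> \<alpha> < 1 \<Longrightarrow>
      measure (density MU fU) {u\<in>space MU. coverage W S u \<le> \<alpha>} \<le> \<alpha>"
    and A: "A \<in> sets (restrict_space borel \<Theta>)"
  shows "bel \<Theta> a W S y A \<le>
    measure (distr (R \<Otimes>\<^sub>M density MU fU) (restrict_space borel \<Theta>) (\<lambda>(v, u). Q v u)) A"
proof -
  interpret P: prob_space "density MU fU" by fact
  interpret R: prob_space R
    using sel by (simp add: selection_rule_def)
  interpret W: prob_space W
    using prs by (simp add: predictive_random_set_def)
  interpret RP: pair_prob_space R "density MU fU" ..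
  have Q: "(\<lambda>(v, u). Q v u) \<in> measurable (R \<Otimes>\<^sub>M density MU fU) (restrict_space borel \<Theta>)"
    using sel by (simp add: selection_rule_def cong: measurable_cong_sets)
  let ?\<mu> = "distr (R \<Otimes>\<^sub>M density MU fU) (restrict_space borel \<Theta>) (\<lambda>(v, u). Q v u)"
  let ?M0 = "fid_region MU a nrm y R Q 0"
  interpret \<mu>: prob_space ?\<mu>
    using Q by (rule RP.prob_space_distr)
  define T where "T \<omega> = random_param_set \<Theta> a y (S \<omega>)" for \<omega>
  define E where "E = {\<omega>\<in>space W. T \<omega> \<subseteq> A \<and> T \<omega> \<noteq> {}}"
  define \<alpha> where "\<alpha> = 1 - outer_prob W E"
  define G where "G t = {u\<in>space MU. coverage W S u \<le> t}" for t
  have G: "G t \<in> P.events" for t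
    using prs by (auto simp: predictive_random_set_def G_def)
  have M0: "?M0 \<in> P.events"
    using fid_region_measurable[OF assoc sel] by simp
  have bel: "bel \<Theta> a W S y A = outer_prob W E"
    using outer_prob_nonempty[OF P assoc(3) sel full prs valid] by (simp add: bel_def E_def T_def)
  have "outer_prob W E \<le> outer_prob W (space W)"
    by (rule W.outer_prob_mono) (auto simp: E_def)
  then have \<alpha>0: "0 \<le> \<alpha>"
    by (simp add: \<alpha>_def outer_prob_eq_measure W.prob_space)
  \<comment> \<open>Whenever \<open>S \<omega>\<close> contains \<open>u\<close>, the point
    \<open>Q v u\<close> outside \<open>A\<close> lies in \<open>T \<omega>\<close>, so
    \<open>\<omega>\<close> is not in \<open>E\<close>. The conclusion is free of \<open>v\<close>,
    which is what handles a random selection rule.\<close>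
  have cov: "u \<in> G \<alpha>" if "v \<in> space R" "u \<in> ?M0" "Q v u \<notin> A" for v u
  proof -
    have "Q v u \<in> T \<omega>" if "u \<in> S \<omega>" for \<omega>
      using selection_mem_param_set[OF sel assoc(3) \<open>v \<in> space R\<close> \<open>u \<in> ?M0\<close>] that
      by (auto simp: T_def random_param_set_def)
    then have "E \<subseteq> {\<omega>\<in>space W. u \<notin> S \<omega>}"
      using \<open>Q v u \<notin> A\<close> by (auto simp: E_def)
    moreover have "u \<in> space MU"
      using \<open>u \<in> ?M0\<close> by (simp add: fid_region_def)
    ultimately show ?thesis
      using coverage_le_missing[OF prs] by (simp add: G_def \<alpha>_def)
  qed
  \<comment> \<open>Validity is available only strictly between 0 and 1, whereas
    \<open>\<alpha>\<close> can be 0 or 1. Approaching it from above by \<open>t\<close> covers both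
    ends, the bound being trivial for \<open>t \<ge> 1\<close>.\<close>
  have "P.prob (G \<alpha>) \<le> t" if "\<alpha> < t" for t
  proof (cases "t < 1")
    case True
    have "P.prob (G \<alpha>) \<le> P.prob (G t)"
      using that G by (intro P.finite_measure_mono) (auto simp: G_def)
    also have "\<dots> \<le> t"
      using valid True that \<alpha>0 by (simp add: G_def)
    finally show ?thesis .
  qed (use P.prob_le_1[of "G \<alpha>"] in linarith)
  then have PG: "P.prob (G \<alpha>) \<le> \<alpha>"
    by (rule dense_ge)
  let ?B = "{x\<in>space (R \<Otimes>\<^sub>M density MU fU). (case x of (v, u) \<Rightarrow> Q v u) \<notin> A}"
  have null: "P.prob (space MU - ?M0) = 0"
    using P.prob_compl[OF M0] full by simp
  have times: "RP.prob (space R \<times> X) = P.prob X" if "X \<in> P.events" for X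
    using that by (simp add: measure_def P.emeasure_pair_measure_Times R.emeasure_space_1)
  have "1 - \<mu>.prob A = RP.prob ?B"
  proof -
    have "1 - \<mu>.prob A = \<mu>.prob (space ?\<mu> - A)"
      using A by (subst \<mu>.prob_compl) auto
    also have "\<dots> = RP.prob ((\<lambda>(v, u). Q v u) -` (space ?\<mu> - A) \<inter> space (R \<Otimes>\<^sub>M density MU fU))"
      using A Q by (intro measure_distr) auto
    also have "(\<lambda>(v, u). Q v u) -` (space ?\<mu> - A) \<inter> space (R \<Otimes>\<^sub>M density MU fU) = ?B"
      using measurable_space[OF Q] by auto
    finally show ?thesis .
  qed
  \<comment> \<open>By \<open>cov\<close> the event \<open>?B\<close> lies in a rectangle whose
    first side is all of \<open>space R\<close>; points with \<open>u\<close> outside the region go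
    into the null part. The product probability thus reduces to one of \<open>u\<close>
    alone.\<close>
  also have "\<dots> \<le> RP.prob (space R \<times> (G \<alpha> \<union> (space MU - ?M0)))"
    using cov G M0
    by (intro RP.finite_measure_mono) (auto simp: space_pair_measure intro!: pair_measureI)
  also have "\<dots> = P.prob (G \<alpha> \<union> (space MU - ?M0))"
    using G M0 by (intro times) auto
  also have "\<dots> \<le> P.prob (G \<alpha>) + P.prob (space MU - ?M0)"
    using G M0 by (intro measure_Un_le) auto
  also have "\<dots> \<le> \<alpha>"
    using PG null by simp
  finally show ?thesis
    by (simp add: bel \<alpha>_def)
qed

theorem theorem3p1:
  fixes \<Theta> :: "'t::metric_space set"
    and MY :: "'y measure" and f :: "'t \<Rightarrow> 'y \<Rightarrow> ennreal"
    and MU :: "'u measure" and fU :: "'u \<Rightarrow> ennreal"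
    and a :: "'y \<Rightarrow> 't \<Rightarrow> 'u \<Rightarrow> 'c::euclidean_space" and nrm :: "'c \<Rightarrow> real"
    and y :: 'y
    and R :: "'v measure" and Q :: "'v \<Rightarrow> 'u \<Rightarrow> 't"
    and W :: "'w measure" and S :: "'w \<Rightarrow> 'u set"
    and A :: "'t set"
  assumes "association \<Theta> MY f MU fU a"
    and "y \<in> space MY"
    and "is_norm nrm"
    and "selection_rule \<Theta> MU a nrm y R Q"
    and "measure (density MU fU) (fid_region MU a nrm y R Q 0) = 1"
    and "predictive_random_set W MU S"
    and "\<And>\<alpha>::real. 0 < \<alpha> \<Longrightarrow> \<alpha> < 1 \<Longrightarrow>
           measure (density MU fU) {u\<in>space MU. coverage W S u \<le> \<alpha>} \<le> \<alpha>"
    and "A \<in> sets (restrict_space borel \<Theta>)"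
  shows "bel \<Theta> a W S y A \<le> fid \<Theta> MU fU a nrm y R Q A
       \<and> fid \<Theta> MU fU a nrm y R Q A \<le> pl \<Theta> a W S y A"
proof -
  interpret R: prob_space R
    using assms(4) by (simp add: selection_rule_def)
  have Q: "(\<lambda>(v, u). Q v u) \<in> measurable (R \<Otimes>\<^sub>M MU) (restrict_space borel \<Theta>)"
    using assms(4) by (simp add: selection_rule_def)
  obtain v where v: "v \<in> space R"
    using R.not_empty by blast
  \<comment> \<open>A set of measure 1 is nonempty, and a minimizer at one of its points is the
    element of \<open>\<Theta>\<close> that \<open>association_prob_space\<close> requires.\<close>
  obtain u where u: "u \<in> fid_region MU a nrm y R Q 0"
    using assms(5) by fastforce
  from selection_mem_param_set[OF assms(4,3) v u] have "Q v u \<in> \<Theta>"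
    by (simp add: param_set_def)
  from association_prob_space[OF assms(1) this] have P: "prob_space (density MU fU)" .
  then interpret P: prob_space "density MU fU" .
  interpret RP: pair_prob_space R "density MU fU" ..
  let ?\<mu> = "distr (R \<Otimes>\<^sub>M density MU fU) (restrict_space borel \<Theta>) (\<lambda>(v, u). Q v u)"
  interpret \<mu>: prob_space ?\<mu>
    using Q by (intro RP.prob_space_distr) (simp cong: measurable_cong_sets)
  have fid: "fid \<Theta> MU fU a nrm y R Q A = \<mu>.prob A"
    using fid_eq_selection_law[OF assms(1-4) P assms(5)] .
  have bel: "bel \<Theta> a W S y X \<le> \<mu>.prob X" if "X \<in> sets (restrict_space borel \<Theta>)" for X
    using bel_le_fid[OF P assms(1-7) that] .
  \<comment> \<open>Plausibility of \<open>A\<close> is one minus the belief of the complement, so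
    the same inequality for \<open>\<Theta> - A\<close> yields the upper bound.\<close>
  have "\<Theta> - A \<in> sets (restrict_space borel \<Theta>)"
    using sets.compl_sets[OF assms(8)] by (simp add: space_restrict_space)
  from bel[OF this] have "bel \<Theta> a W S y (\<Theta> - A) \<le> 1 - \<mu>.prob A"
    using \<mu>.prob_compl[of A] assms(8) by (simp add: space_restrict_space)
  with bel[OF assms(8)] show ?thesis
    by (simp add: fid pl_def)
qed

end
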